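(* Let $X$ be a finite skew brace of nilpotent type, $G=(X,+)$, $A=(X,\cdot)$, $L=L_\infty(X)$, $Q=G/L$, let $\Delta\le\operatorname{Aut}(Q)$ be the group induced by $\lambda(A)$ on $Q$, let $C=\operatorname{Core}_A(L)$, let $\theta:A\to Q\rtimes\Delta$ be the homomorphism $\theta(a)=(a+L,\overline{\lambda_a})$, and let $H=\theta(A)$. The semidirect product $Q\rtimes\Delta$ acts on the underlying set of $Q$ by $$(q,\delta)\cdot r=q+\delta(r)\qquad(q,r\in Q,\ \delta\in\Delta).$$ Under this action, the group $H$ acts faithfully and transitively, and $$\operatorname{Stab}_H(0+L)=\theta(L)\cong L/C.$$ Consequently, $L$ is an ideal of $X$ if and only if $H$ acts regularly on $Q$.
   Context: A skew (left) brace is a triple $X=(X,+,\cdot)$ such that $(X,+)$ and $(X,\cdot)$ are groups on the same set and $a\cdot(b+c)=a\cdot b-a+a\cdot c$ for all $a,b,c\in X$. The common identity is $0$. $X$ is of nilpotent type if $(X,+)$ is nilpotent. Put $\lambda_a(b)=-a+a\cdot b$; then $\lambda:(X,\cdot)\to\operatorname{Aut}(X,+)$, $a\mapsto\lambda_a$, is a group homomorphism. Put $a*b=\lambda_a(b)-b$; for subsets $S,T$, $S*T$ is the subgroup of $(X,+)$ generated by all $s*t$, $s\in S$, $t\in T$. The left series is $X^1=X$, $X^{n+1}=X*X^n$, and $L_\infty(X)=\bigcap_{n\ge1}X^n$. An ideal of $X$ is a subgroup of $(X,+)$ that is invariant under every $\lambda_a$ and normal in both $(X,+)$ and $(X,\cdot)$.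 For $X$ of nilpotent type, $L=L_\infty(X)$ is a normal subgroup of $(X,+)$ invariant under all $\lambda_a$, and also a subgroup of $(X,\cdot)$; hence $Q=G/L$ is a group (written additively, possibly nonabelian) and each $\lambda_a$ induces an automorphism $\overline{\lambda_a}$ of $Q$; $\Delta=\{\overline{\lambda_a}:a\in A\}$. Multiplication in $Q\rtimes\Delta$ is $(q,\alpha)(r,\beta)=(q+\alpha(r),\alpha\beta)$, and $\theta$ is a group homomorphism. $\operatorname{Core}_A(L)$ is the largest normal subgroup of $A$ contained in $L$; the quotient $L/C$ is taken in $(X,\cdot)$. A group acts regularly if it acts transitively with trivial point stabilizers. *)

theory Defs
  imports "HOL-Algebra.Generated_Groups" "HOL-Algebra.Group_Action"
begin

text \<open>
  A skew brace is a pair of groups on one carrier: \<open>G\<close> is the additive group \<open>(X,+)\<close>,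
  written multiplicatively as usual in HOL-Algebra, and \<open>A\<close> is the multiplicative
  group \<open>(X,\<cdot>)\<close>.
\<close>

locale skew_brace = add: group G + mul: group A
  for G :: "'a monoid" and A :: "'a monoid" +
  assumes same_carrier: "carrier A = carrier G"
    and brace_distrib: "\<lbrakk>a \<in> carrier G; b \<in> carrier G; c \<in> carrier G\<rbrakk> \<Longrightarrow>
      a \<otimes>\<^bsub>A\<^esub> (b \<otimes>\<^bsub>G\<^esub> c) = (a \<otimes>\<^bsub>A\<^esub> b) \<otimes>\<^bsub>G\<^esub> inv\<^bsub>G\<^esub> a \<otimes>\<^bsub>G\<^esub> (a \<otimes>\<^bsub>A\<^esub> c)"

lemma (in skew_brace) common_identity: "\<one>\<^bsub>A\<^esub> = \<one>\<^bsub>G\<^esub>"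
proof -
  have m: "\<one>\<^bsub>A\<^esub> \<in> carrier G"
    using mul.one_closed same_carrier by simp
  have "\<one>\<^bsub>G\<^esub> = \<one>\<^bsub>A\<^esub> \<otimes>\<^bsub>A\<^esub> (\<one>\<^bsub>G\<^esub> \<otimes>\<^bsub>G\<^esub> \<one>\<^bsub>G\<^esub>)"
    using same_carrier by simp
  also have "\<dots> = \<one>\<^bsub>G\<^esub> \<otimes>\<^bsub>G\<^esub> inv\<^bsub>G\<^esub> \<one>\<^bsub>A\<^esub> \<otimes>\<^bsub>G\<^esub> \<one>\<^bsub>G\<^esub>"
    using m same_carrier by (subst brace_distrib) simp_all
  finally have "inv\<^bsub>G\<^esub> \<one>\<^bsub>A\<^esub> = \<one>\<^bsub>G\<^esub>"
    using m by simp
  then show ?thesis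
    using m add.inv_eq_1_iff by simp
qed

primrec lower_central :: "('a, 'b) monoid_scheme \<Rightarrow> nat \<Rightarrow> 'a set" where
  "lower_central G 0 = carrier G"
| "lower_central G (Suc n) =
     generate G {x \<otimes>\<^bsub>G\<^esub> y \<otimes>\<^bsub>G\<^esub> inv\<^bsub>G\<^esub> x \<otimes>\<^bsub>G\<^esub> inv\<^bsub>G\<^esub> y | x y. x \<in> carrier G \<and> y \<in> lower_central G n}"

definition nilpotent_group :: "('a, 'b) monoid_scheme \<Rightarrow> bool" where
  "nilpotent_group G \<longleftrightarrow> group G \<and> (\<exists>n. lower_central G n = {\<one>\<^bsub>G\<^esub>})"

text \<open>
  The maps \<open>\<lambda>\<^sub>a\<close> are extensional on the carrier, so that they can be elements of
  \<^const>\<open>AutoGroup\<close>.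
\<close>

definition brace_lambda :: "'a monoid \<Rightarrow> 'a monoid \<Rightarrow> 'a \<Rightarrow> 'a \<Rightarrow> 'a" where
  "brace_lambda G A a = (\<lambda>b\<in>carrier G. inv\<^bsub>G\<^esub> a \<otimes>\<^bsub>G\<^esub> (a \<otimes>\<^bsub>A\<^esub> b))"

definition brace_star :: "'a monoid \<Rightarrow> 'a monoid \<Rightarrow> 'a \<Rightarrow> 'a \<Rightarrow> 'a" where
  "brace_star G A a b = brace_lambda G A a b \<otimes>\<^bsub>G\<^esub> inv\<^bsub>G\<^esub> b"

definition set_star :: "'a monoid \<Rightarrow> 'a monoid \<Rightarrow> 'a set \<Rightarrow> 'a set \<Rightarrow> 'a set" where
  "set_star G A S T = generate G {brace_star G A s t | s t. s \<in> S \<and> t \<in> T}"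

text \<open>The left series is indexed from 1; the value at index 0 is never used.\<close>

definition left_series :: "'a monoid \<Rightarrow> 'a monoid \<Rightarrow> nat \<Rightarrow> 'a set" where
  "left_series G A n = (set_star G A (carrier G) ^^ (n - 1)) (carrier G)"

lemma left_series_1: "left_series G A 1 = carrier G"
  by (simp add: left_series_def)

lemma left_series_Suc:
  "n \<ge> 1 \<Longrightarrow> left_series G A (Suc n) = set_star G A (carrier G) (left_series G A n)"
  by (cases n) (simp_all add: left_series_def)

definition L_infty :: "'a monoid \<Rightarrow> 'a monoid \<Rightarrow> 'a set" where
  "L_infty G A = (\<Inter>n\<in>{1..}. left_series G A n)"

definition brace_ideal :: "'a monoid \<Rightarrow> 'a monoid \<Rightarrow> 'a set \<Rightarrow> bool" where
  "brace_ideal G A I \<longleftrightarrow>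
     subgroup I G \<and> (\<forall>a\<in>carrier A. brace_lambda G A a ` I \<subseteq> I) \<and> I \<lhd> G \<and> I \<lhd> A"

definition normal_core :: "('a, 'b) monoid_scheme \<Rightarrow> 'a set \<Rightarrow> 'a set" where
  "normal_core A L = (GREATEST N. N \<lhd> A \<and> N \<subseteq> L)"

text \<open>
  The map induced by \<open>f\<close> on the quotient by \<open>L\<close> sends a coset to its image under \<open>f\<close>:
  if \<open>f\<close> is an automorphism with \<open>f(L) = L\<close>, then \<open>f(b + L) = f(b) + L\<close> as sets.
\<close>

definition induced_map :: "('a, 'b) monoid_scheme \<Rightarrow> 'a set \<Rightarrow> ('a \<Rightarrow> 'a) \<Rightarrow> 'a set \<Rightarrow> 'a set" where
  "induced_map G L f = (\<lambda>U\<in>carrier (G Mod L). f ` U)"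

text \<open>
  Semidirect product of \<open>Q\<close> with a group \<open>D\<close> whose elements are themselves
  automorphisms of \<open>Q\<close>, and its affine action on the carrier of \<open>Q\<close>.
\<close>

definition semidirect ::
  "('q, 'b) monoid_scheme \<Rightarrow> ('q \<Rightarrow> 'q) monoid \<Rightarrow> ('q \<times> ('q \<Rightarrow> 'q)) monoid" where
  "semidirect Q D =
     \<lparr>carrier = carrier Q \<times> carrier D,
      mult = (\<lambda>(q, \<alpha>) (r, \<beta>). (q \<otimes>\<^bsub>Q\<^esub> \<alpha> r, \<alpha> \<otimes>\<^bsub>D\<^esub> \<beta>)),
      one = (\<one>\<^bsub>Q\<^esub>, \<one>\<^bsub>D\<^esub>)\<rparr>"

definition affine_act :: "('q, 'b) monoid_scheme \<Rightarrow> 'q \<times> ('q \<Rightarrow> 'q) \<Rightarrow> 'q \<Rightarrow> 'q" where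
  "affine_act Q = (\<lambda>(q, \<delta>). \<lambda>r\<in>carrier Q. q \<otimes>\<^bsub>Q\<^esub> \<delta> r)"

definition regular_action ::
  "('g, 'b) monoid_scheme \<Rightarrow> 'e set \<Rightarrow> ('g \<Rightarrow> 'e \<Rightarrow> 'e) \<Rightarrow> bool" where
  "regular_action G E \<phi> \<longleftrightarrow>
     transitive_action G E \<phi> \<and> (\<forall>x\<in>E. stabilizer G \<phi> x = {\<one>\<^bsub>G\<^esub>})"

end

theory Submission
  imports Defs "HOL-Algebra.Zassenhaus"
begin

text \<open>
  Two quite different facts are involved. Once \<open>L\<close> is known to be a normal subgroup of \<open>G\<close> invariant
  under all \<open>\<lambda>\<^sub>a\<close> (a strong left ideal), everything about \<open>H\<close> follows from the identity
  \<open>a \<cdot> b = a + \<lambda>\<^sub>a(b)\<close>: it says that \<open>\<theta>(a)\<close> sends the coset \<open>b + L\<close> to \<open>a \<cdot> b + L\<close>, so \<open>H\<close> acts on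
  \<open>Q\<close> as \<open>A\<close> acts by translation on its left cosets modulo the subgroup \<open>L\<close>. This action is
  transitive, the stabilizer of the base point consists of the images of \<open>L\<close>, and the kernel of the
  action is the core of \<open>L\<close>. The semidirect product acts faithfully, so this kernel is also the
  kernel of \<open>\<theta>\<close>, and the first isomorphism theorem gives \<open>\<theta>(L) \<cong> L/C\<close>. Finally, \<open>L\<close> is an ideal
  iff it is normal in \<open>A\<close>, iff it equals its core, iff the stabilizer \<open>\<theta>(L)\<close> is trivial. All
  this takes place in the locale \<open>strong_left_ideal\<close>.

  The substantial point is that \<open>L_\<infinity>(X)\<close> is normal in \<open>(X,+)\<close> when the latter is finite nilpotent
  (\<open>stable_op_series_normal\<close>). The usual argument treats each Sylow subgroup \<open>P\<close> separately and
  identifies the stable term with the commutator of \<open>P\<close> with the operators of order prime to \<open>p\<close>.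
  The argument below works instead for any set of endomorphisms and any nilpotent group whose
  operator series reaches a term \<open>L\<close> with \<open>[L, \<Phi>] = L\<close>, and needs no arithmetic. With the
  lower central series \<open>\<gamma>\<^sub>j\<close>, one shows by induction on \<open>j\<close> that \<open>\<gamma>\<^sub>j L\<close> is normal; at the end
  of the series this is \<open>L\<close> itself. In the step, let \<open>N\<close> be the normalizer of
  \<open>B = \<gamma>\<^sub>j\<^sub>+\<^sub>1 L\<close>. As the group is nilpotent and as the operators act nilpotently above \<open>L\<close>, if \<open>N\<close>
  were proper there would be an element \<open>h\<close> outside \<open>N\<close> that normalizes \<open>N\<close> and is fixed by the
  operators modulo \<open>N\<close>. For such \<open>h\<close> the conjugate of \<open>B\<close> is again invariant under the operators,
  and invariant conjugates of \<open>B\<close> coincide with \<open>B\<close> (\<open>conjugate_subset\<close>).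
\<close>

section \<open>Products of subgroups and the lower central series\<close>

context group
begin

lemma inv_mult_cancel [simp]:
  "\<lbrakk>x \<in> carrier G; y \<in> carrier G\<rbrakk> \<Longrightarrow> inv x \<otimes> (x \<otimes> y) = y"
  "\<lbrakk>x \<in> carrier G; y \<in> carrier G\<rbrakk> \<Longrightarrow> x \<otimes> (inv x \<otimes> y) = y"
  by (simp_all flip: m_assoc)

(* The description by generators gets in the way of the normality and commutator rules. *)
declare lower_central.simps(2) [simp del]

lemma subset_set_mult_normal: "\<lbrakk>subgroup N G; H \<subseteq> carrier G\<rbrakk> \<Longrightarrow> H \<subseteq> N <#> H"
  using mono_set_mult[of "{\<one>}" N H H G] subgroup.one_closed[of N G]
  by (auto simp: set_mult_def subset_iff)

lemma subset_set_mult_subgroup: "\<lbrakk>subgroup H G; N \<subseteq> carrier G\<rbrakk> \<Longrightarrow> N \<subseteq> N <#> H"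
  using mono_set_mult[of N N "{\<one>}" H G] subgroup.one_closed[of H G]
  by (auto simp: set_mult_def subset_iff)

lemma subgroup_conjugate:
  assumes "subgroup H G" "h \<in> carrier G"
  shows "subgroup ((\<lambda>b. h \<otimes> b \<otimes> inv h) ` H) G"
proof -
  interpret H: subgroup H G by (rule assms(1))
  have "group_hom G G (\<lambda>b. h \<otimes> b \<otimes> inv h)"
    using assms(2) by unfold_locales (auto simp: hom_def m_assoc)
  then show ?thesis
    by (rule group_hom.subgroup_img_is_subgroup[OF _ assms(1)])
qed

lemma lower_central_normal: "lower_central G n \<lhd> G"
proof (induction n)
  case 0
  then show ?case
    by (simp add: normal_inv_iff subgroup_self)
next
  case (Suc n)
  interpret N: normal "lower_central G n" G by (rule Suc)
  show ?case
    unfolding lower_central.simps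
  proof (rule normal_generateI)
    show "{x \<otimes> y \<otimes> inv x \<otimes> inv y |x y. x \<in> carrier G \<and> y \<in> lower_central G n} \<subseteq> carrier G"
      by auto
    fix h g
    assume "h \<in> {x \<otimes> y \<otimes> inv x \<otimes> inv y |x y. x \<in> carrier G \<and> y \<in> lower_central G n}"
      and g: "g \<in> carrier G"
    then obtain x y where xy: "x \<in> carrier G" "y \<in> lower_central G n"
      and h: "h = x \<otimes> y \<otimes> inv x \<otimes> inv y"
      by blast
    have "g \<otimes> h \<otimes> inv g
      = (g \<otimes> x \<otimes> inv g) \<otimes> (g \<otimes> y \<otimes> inv g) \<otimes> inv (g \<otimes> x \<otimes> inv g) \<otimes> inv (g \<otimes> y \<otimes> inv g)"
      using g xy(1) N.mem_carrier[OF xy(2)] by (simp add: h m_assoc inv_mult_group)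
    moreover have "g \<otimes> y \<otimes> inv g \<in> lower_central G n"
      using g xy(2) by (rule N.inv_op_closed2)
    ultimately show "g \<otimes> h \<otimes> inv g
        \<in> {x \<otimes> y \<otimes> inv x \<otimes> inv y |x y. x \<in> carrier G \<and> y \<in> lower_central G n}"
      using g xy(1) by blast
  qed
qed

lemma commutator_in_lower_central:
  assumes "x \<in> carrier G" "y \<in> lower_central G n"
  shows "x \<otimes> y \<otimes> inv x \<otimes> inv y \<in> lower_central G (Suc n)"
  using assms by (auto simp: lower_central.simps(2) intro: generate.incl)

lemma lower_central_decreasing: "lower_central G (Suc n) \<subseteq> lower_central G n"
proof -
  interpret N: normal "lower_central G n" G by (rule lower_central_normal)
  have "x \<otimes> y \<otimes> inv x \<otimes> inv y \<in> lower_central G n"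
    if "x \<in> carrier G" "y \<in> lower_central G n" for x y
    using that by (simp add: N.inv_op_closed2)
  then show ?thesis
    unfolding lower_central.simps by (intro generate_subgroup_incl N.subgroup_axioms) auto
qed

end

section \<open>The operator series of a nilpotent group\<close>

locale operator_group = group +
  fixes \<Phi> :: "('a \<Rightarrow> 'a) set"
  assumes operator_hom: "\<phi> \<in> \<Phi> \<Longrightarrow> \<phi> \<in> hom G G"
begin

lemma operator_group_hom: "\<phi> \<in> \<Phi> \<Longrightarrow> group_hom G G \<phi>"
  by (simp add: operator_hom group_hom.intro group_hom_axioms.intro group_axioms)

lemma operator_closed: "\<lbrakk>\<phi> \<in> \<Phi>; x \<in> carrier G\<rbrakk> \<Longrightarrow> \<phi> x \<in> carrier G"
  by (rule group_hom.hom_closed[OF operator_group_hom])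

lemma operator_mult:
  "\<lbrakk>\<phi> \<in> \<Phi>; x \<in> carrier G; y \<in> carrier G\<rbrakk> \<Longrightarrow> \<phi> (x \<otimes> y) = \<phi> x \<otimes> \<phi> y"
  by (rule group_hom.hom_mult[OF operator_group_hom])

lemma operator_inv: "\<lbrakk>\<phi> \<in> \<Phi>; x \<in> carrier G\<rbrakk> \<Longrightarrow> \<phi> (inv x) = inv \<phi> x"
  by (rule group_hom.hom_inv[OF operator_group_hom])

text \<open>
  Left unrestricted, the equations for operators have a variable function as the head of their left
  sides and match almost anything, so they are instantiated with a given operator before use.
\<close>

lemmas operator_simps = operator_closed operator_mult operator_inv

lemma operator_generate:
  assumes "\<phi> \<in> \<Phi>" "K \<subseteq> carrier G" "\<And>x. x \<in> K \<Longrightarrow> \<phi> x \<in> generate G K"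
    and "x \<in> generate G K"
  shows "\<phi> x \<in> generate G K"
  using assms(4)
proof (induction rule: generate.induct)
  case one
  then show ?case
    using group_hom.hom_one[OF operator_group_hom[OF assms(1)]] by (simp add: generate.one)
next
  case (incl h)
  then show ?case by (rule assms(3))
next
  case (inv h)
  then show ?case
    using assms(1,2) generate_m_inv_closed[OF assms(2) assms(3)[OF inv]] operator_inv[OF assms(1)] by auto
next
  case (eng h1 h2)
  then show ?case
    using assms(2) generate_in_carrier by (simp add: operator_mult[OF assms(1)] generate.eng)
qed

lemma operator_lower_central:
  assumes "\<phi> \<in> \<Phi>"
  shows "x \<in> lower_central G n \<Longrightarrow> \<phi> x \<in> lower_central G n"
proof (induction n arbitrary: x)
  case 0
  then show ?case using operator_closed[OF assms] by simp
next
  case (Suc n)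
  have carr: "lower_central G n \<subseteq> carrier G"
    using lower_central_normal normal_imp_subgroup subgroup.subset by blast
  show ?case
    unfolding lower_central.simps
  proof (rule operator_generate[OF assms _ _ Suc.prems[unfolded lower_central.simps]])
    show "{x \<otimes> y \<otimes> inv x \<otimes> inv y |x y. x \<in> carrier G \<and> y \<in> lower_central G n} \<subseteq> carrier G"
      using carr by auto
    fix h
    assume "h \<in> {x \<otimes> y \<otimes> inv x \<otimes> inv y |x y. x \<in> carrier G \<and> y \<in> lower_central G n}"
    then obtain x y where "x \<in> carrier G" "y \<in> lower_central G n"
      and "h = x \<otimes> y \<otimes> inv x \<otimes> inv y"
      by blast
    then show "\<phi> h \<in> generate G
        {x \<otimes> y \<otimes> inv x \<otimes> inv y |x y. x \<in> carrier G \<and> y \<in> lower_central G n}"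
      using assms carr Suc.IH[of y]
      by (intro generate.incl CollectI exI[of _ "\<phi> x"] exI[of _ "\<phi> y"]) (auto simp: subset_iff operator_simps[OF assms])
  qed
qed

text \<open>
  The commutator of \<open>S\<close> with the operators, computed in the semidirect product when these are
  automorphisms.
\<close>

definition op_commutator :: "'a set \<Rightarrow> 'a set" where
  "op_commutator S = generate G {\<phi> s \<otimes> inv s | \<phi> s. \<phi> \<in> \<Phi> \<and> s \<in> S}"

abbreviation op_series :: "nat \<Rightarrow> 'a set" where
  "op_series n \<equiv> (op_commutator ^^ n) (carrier G)"

definition invariant_subgroup :: "'a set \<Rightarrow> bool" where
  "invariant_subgroup K \<longleftrightarrow> subgroup K G \<and> (\<forall>\<phi>\<in>\<Phi>. \<forall>x\<in>K. \<phi> x \<in> K)"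

lemma op_commutator_incl:
  "\<lbrakk>\<phi> \<in> \<Phi>; s \<in> S\<rbrakk> \<Longrightarrow> \<phi> s \<otimes> inv s \<in> op_commutator S"
  unfolding op_commutator_def by (auto intro: generate.incl)

lemma op_commutator_least:
  "\<lbrakk>subgroup K G; \<And>\<phi> s. \<lbrakk>\<phi> \<in> \<Phi>; s \<in> S\<rbrakk> \<Longrightarrow> \<phi> s \<otimes> inv s \<in> K\<rbrakk> \<Longrightarrow> op_commutator S \<subseteq> K"
  unfolding op_commutator_def by (rule generate_subgroup_incl) auto

lemma op_commutator_subset:
  assumes "invariant_subgroup K"
  shows "op_commutator K \<subseteq> K"
proof -
  interpret K: subgroup K G using assms by (simp add: invariant_subgroup_def)
  have "\<phi> s \<otimes> inv s \<in> K" if "\<phi> \<in> \<Phi>" "s \<in> K" for \<phi> s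
    using assms that by (intro K.m_closed K.m_inv_closed) (simp_all add: invariant_subgroup_def)
  then show ?thesis
    by (rule op_commutator_least[OF K.subgroup_axioms])
qed

lemma invariant_op_commutator:
  assumes "invariant_subgroup K"
  shows "invariant_subgroup (op_commutator K)"
proof -
  interpret K: subgroup K G using assms by (simp add: invariant_subgroup_def)
  have sub: "subgroup (op_commutator K) G"
    unfolding op_commutator_def by (rule generate_is_subgroup) (auto simp: operator_closed)
  interpret C: subgroup "op_commutator K" G by (rule sub)
  have "\<phi> x \<in> op_commutator K" if "\<phi> \<in> \<Phi>" "x \<in> op_commutator K" for \<phi> x
  proof -
    have "x \<in> K" using op_commutator_subset[OF assms] that(2) by blast
    then have "\<phi> x \<otimes> inv x \<otimes> x \<in> op_commutator K"
      using that by (intro C.m_closed op_commutator_incl)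
    then show ?thesis using \<open>x \<in> K\<close> by (simp add: m_assoc operator_closed[OF that(1)])
  qed
  with sub show ?thesis by (simp add: invariant_subgroup_def)
qed

lemma invariant_op_series: "invariant_subgroup (op_series n)"
  by (induction n) (simp_all add: invariant_op_commutator, simp add: invariant_subgroup_def subgroup_self operator_closed)

lemma op_series_decreasing: "op_series (Suc n) \<subseteq> op_series n"
  using op_commutator_subset[OF invariant_op_series] by simp

text \<open>
  Modulo \<open>Y\<close> the subgroup \<open>B\<close>, its conjugate \<open>B'\<close> by \<open>h\<close> and \<open>L\<close> all agree. Since \<open>L\<close> is its own
  commutator with the operators, commutators may be taken on the side of \<open>B'\<close>: each element of \<open>L\<close>
  is, modulo \<open>Y\<close>, an element of \<open>B'\<close> lying arbitrarily deep in the operator series, hence in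
  \<open>B' \<inter> L\<close>. So \<open>B'\<close> is generated by \<open>B' \<inter> L\<close> and \<open>B' \<inter> Y\<close>, and the latter lies in \<open>B\<close>
  because it is the conjugate of \<open>B \<inter> Y\<close>.
\<close>

lemma conjugate_subset:
  assumes L: "subgroup L G" "L \<subseteq> op_commutator L" "op_series m \<subseteq> L"
    and Y: "Y \<lhd> G" "invariant_subgroup Y" "Y <#> L \<lhd> G"
    and B: "subgroup B G" "L \<subseteq> B" "B \<subseteq> Y <#> L"
    and h: "h \<in> carrier G"
    and inter: "\<And>y. y \<in> Y \<inter> B \<Longrightarrow> h \<otimes> y \<otimes> inv h \<in> B"
    and conj: "invariant_subgroup ((\<lambda>b. h \<otimes> b \<otimes> inv h) ` B)"
  shows "(\<lambda>b. h \<otimes> b \<otimes> inv h) ` B \<subseteq> B"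
proof -
  define B' where "B' = (\<lambda>b. h \<otimes> b \<otimes> inv h) ` B"
  interpret L: subgroup L G by (rule L(1))
  interpret Y: normal Y G by (rule Y(1))
  interpret M: normal "Y <#> L" G by (rule Y(3))
  interpret B': subgroup B' G
    using conj by (simp add: invariant_subgroup_def B'_def)
  have B_carrier: "B \<subseteq> carrier G" using B(3) M.subset by blast
  have start: "L \<subseteq> Y <#> B'"
  proof
    fix l assume l: "l \<in> L"
    have "l = \<one> \<otimes> l" using l by simp
    then have "l \<in> Y <#> L" unfolding set_mult_def using l Y.one_closed by blast
    then have "inv h \<otimes> l \<otimes> h \<in> Y <#> L" by (rule M.inv_op_closed1[OF h])
    then obtain y k where yk: "y \<in> Y" "k \<in> L" "inv h \<otimes> l \<otimes> h = y \<otimes> k"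
      by (auto simp: set_mult_def)
    have "l = h \<otimes> (inv h \<otimes> l \<otimes> h) \<otimes> inv h" using l h by (simp add: m_assoc)
    also have "\<dots> = (h \<otimes> y \<otimes> inv h) \<otimes> (h \<otimes> k \<otimes> inv h)"
      using yk h by (simp add: m_assoc)
    finally show "l \<in> Y <#> B'"
      unfolding set_mult_def B'_def using Y.inv_op_closed2[OF h yk(1)] yk(2) B(2) by blast
  qed
  \<comment> \<open>For \<open>l = y d\<close> the commutator \<open>\<phi>(l) l\<^sup>-\<^sup>1\<close> agrees modulo \<open>Y\<close> with \<open>u = \<phi>(d) d\<^sup>-\<^sup>1\<close>, which lies one
      term deeper in the operator series and still in \<open>B'\<close>.\<close>
  have "L \<subseteq> Y <#> (B' \<inter> op_series n)" for n
  proof (induction n)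
    case 0
    then show ?case using start B'.subset by (simp add: Int_absorb2)
  next
    case (Suc n)
    interpret X: subgroup "op_series (Suc n)" G
      using invariant_op_series unfolding invariant_subgroup_def by blast
    have sub: "subgroup (B' \<inter> op_series (Suc n)) G"
      by (rule subgroups_Inter_pair[OF B'.subgroup_axioms X.subgroup_axioms])
    have "op_commutator L \<subseteq> Y <#> (B' \<inter> op_series (Suc n))"
    proof (rule op_commutator_least)
      show "subgroup (Y <#> (B' \<inter> op_series (Suc n))) G"
        by (rule mult_norm_subgroup[OF Y(1) sub])
      fix \<phi> l assume \<phi>: "\<phi> \<in> \<Phi>" and "l \<in> L"
      then obtain y d where yd: "y \<in> Y" "d \<in> B'" "d \<in> op_series n" "l = y \<otimes> d"
        using Suc.IH by (auto simp: set_mult_def)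
      define u where "u = \<phi> d \<otimes> inv d"
      have \<phi>y: "\<phi> y \<in> Y" using Y(2) \<phi> yd(1) by (simp add: invariant_subgroup_def)
      have u: "u \<in> B'" "u \<in> op_series (Suc n)"
        using conj \<phi> yd op_commutator_incl[OF \<phi> yd(3)]
        by (auto simp: u_def B'_def[symmetric] invariant_subgroup_def)
      have "\<phi> l \<otimes> inv l = (\<phi> y \<otimes> (u \<otimes> inv y \<otimes> inv u)) \<otimes> u"
        using yd(1,2) by (simp add: yd(4) u_def m_assoc inv_mult_group operator_simps[OF \<phi>])
      moreover have "\<phi> y \<otimes> (u \<otimes> inv y \<otimes> inv u) \<in> Y"
        using \<phi>y yd(1) u(1) by (intro Y.m_closed Y.inv_op_closed2) auto
      ultimately show "\<phi> l \<otimes> inv l \<in> Y <#> (B' \<inter> op_series (Suc n))"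
        using u unfolding set_mult_def by blast
    qed
    with L(2) show ?case by blast
  qed
  from this[of m] L(3) have dec: "L \<subseteq> Y <#> (B' \<inter> L)"
    unfolding set_mult_def by blast
  have "b' \<in> B" if "b' \<in> B'" for b'
  proof -
    obtain b where b: "b \<in> B" "b' = h \<otimes> b \<otimes> inv h"
      using \<open>b' \<in> B'\<close> by (auto simp: B'_def)
    then have "b' \<in> Y <#> L" using B(3) M.inv_op_closed2[OF h] by blast
    then obtain y0 l where "y0 \<in> Y" "l \<in> L" "b' = y0 \<otimes> l" by (auto simp: set_mult_def)
    moreover obtain y1 d where d: "y1 \<in> Y" "d \<in> B'" "d \<in> L" "l = y1 \<otimes> d"
      using dec \<open>l \<in> L\<close> by (auto simp: set_mult_def)
    ultimately have y: "y0 \<otimes> y1 \<in> Y" "b' = (y0 \<otimes> y1) \<otimes> d" by (simp_all add: m_assoc)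
    have "y0 \<otimes> y1 = b' \<otimes> inv d" using y(1) d(2) by (simp add: y(2) m_assoc)
    also have "\<dots> \<in> B'" using that d(2) by simp
    finally obtain c where c: "c \<in> B" "y0 \<otimes> y1 = h \<otimes> c \<otimes> inv h" by (auto simp: B'_def)
    have "c = inv h \<otimes> (y0 \<otimes> y1) \<otimes> h" using c h B_carrier by (auto simp: m_assoc subset_iff)
    then have "c \<in> Y" using Y.inv_op_closed1[OF h y(1)] by simp
    then have "y0 \<otimes> y1 \<in> B" using inter c by simp
    then show ?thesis using d(3) B(2) subgroup.m_closed[OF B(1)] by (auto simp: y(2))
  qed
  then show ?thesis by (auto simp: B'_def)
qed

text \<open>
  The normalizer \<open>N\<close> of \<open>B\<close> absorbs the lower central terms from the bottom upwards and, inside each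
  of them, the intersections with the operator series from the bottom upwards. Going up one step in
  both at once is what makes the elements \<open>h\<close> in question normalize \<open>N\<close> and be fixed by the
  operators modulo \<open>N\<close>.
\<close>

lemma normal_lower_central_step:
  assumes L: "invariant_subgroup L" "L \<subseteq> op_commutator L" "op_series m \<subseteq> L"
    and nil: "lower_central G c = {\<one>}"
    and norm: "lower_central G j <#> L \<lhd> G"
  shows "lower_central G (Suc j) <#> L \<lhd> G"
proof -
  let ?\<gamma> = "lower_central G"
  define B where "B = ?\<gamma> (Suc j) <#> L"
  (* Both directions are asked for: a single one does not make conjugation map B onto itself. *)
  define N where "N = {g \<in> carrier G. \<forall>b\<in>B. g \<otimes> b \<otimes> inv g \<in> B \<and> inv g \<otimes> b \<otimes> g \<in> B}"
  interpret L: subgroup L G using L(1) by (simp add: invariant_subgroup_def)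
  interpret W: normal "?\<gamma> (Suc j)" G by (rule lower_central_normal)
  interpret Y: normal "?\<gamma> j" G by (rule lower_central_normal)
  have "subgroup B G"
    unfolding B_def by (rule mult_norm_subgroup[OF W.normal_axioms L.subgroup_axioms])
  then interpret B: subgroup B G .
  have L_le: "L \<subseteq> B"
    unfolding B_def by (rule subset_set_mult_normal[OF W.subgroup_axioms L.subset])
  have W_le: "?\<gamma> (Suc j) \<subseteq> B"
    unfolding B_def by (rule subset_set_mult_subgroup[OF L.subgroup_axioms W.subset])
  have B_le: "B \<subseteq> ?\<gamma> j <#> L"
    unfolding B_def by (intro mono_set_mult lower_central_decreasing order_refl)
  have B_inv: "\<phi> b \<in> B" if "\<phi> \<in> \<Phi>" "b \<in> B" for \<phi> b
  proof -
    obtain w l where wl: "w \<in> ?\<gamma> (Suc j)" "l \<in> L" "b = w \<otimes> l"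
      using \<open>b \<in> B\<close> unfolding B_def set_mult_def by blast
    then have "\<phi> w \<in> ?\<gamma> (Suc j)" "\<phi> l \<in> L"
      using that(1) operator_lower_central[OF that(1) wl(1)] L(1)
      by (simp_all add: invariant_subgroup_def)
    moreover have "\<phi> b = \<phi> w \<otimes> \<phi> l"
      using wl(1,2) by (simp add: wl(3) operator_mult[OF that(1)])
    ultimately show ?thesis unfolding B_def set_mult_def by blast
  qed
  have B_le_N: "B \<subseteq> N"
    by (auto simp: N_def)
  have N_mult: "g \<otimes> k \<in> N" if "g \<in> N" "k \<in> N" for g k
  proof -
    have carr: "g \<in> carrier G" "k \<in> carrier G" using that by (auto simp: N_def)
    have "g \<otimes> k \<otimes> b \<otimes> inv (g \<otimes> k) \<in> B" "inv (g \<otimes> k) \<otimes> b \<otimes> (g \<otimes> k) \<in> B" if b: "b \<in> B" for b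
    proof -
      have "g \<otimes> (k \<otimes> b \<otimes> inv k) \<otimes> inv g \<in> B" "inv k \<otimes> (inv g \<otimes> b \<otimes> g) \<otimes> k \<in> B"
        using \<open>g \<in> N\<close> \<open>k \<in> N\<close> b by (auto simp: N_def)
      then show "g \<otimes> k \<otimes> b \<otimes> inv (g \<otimes> k) \<in> B" "inv (g \<otimes> k) \<otimes> b \<otimes> (g \<otimes> k) \<in> B"
        using carr b by (simp_all add: m_assoc inv_mult_group)
    qed
    with carr show ?thesis by (simp add: N_def)
  qed
  have "?\<gamma> i \<subseteq> N" if "i \<le> c" for i
    using that
  proof (induction rule: inc_induct)
    case base
    then show ?case using nil B.one_closed B_le_N by auto
  next
    case (step i)
    interpret I: normal "?\<gamma> i" G by (rule lower_central_normal)
    have "?\<gamma> i \<inter> op_series n \<subseteq> N" if "n \<le> m" for n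
      using that
    proof (induction rule: inc_induct)
      case base
      then show ?case using L(3) L_le B_le_N by blast
    next
      case X: (step n)
      interpret X: subgroup "op_series n" G
        using invariant_op_series by (simp add: invariant_subgroup_def)
      have into: "h \<otimes> b \<otimes> inv h \<in> B" if h: "h \<in> ?\<gamma> i" "h \<in> op_series n" and b: "b \<in> B" for h b
      proof -
        have hc: "h \<in> carrier G" using h(1) by (rule I.mem_carrier)
        have "(\<lambda>b. h \<otimes> b \<otimes> inv h) ` B \<subseteq> B"
        proof (rule conjugate_subset[where Y = "?\<gamma> j" and L = L and m = m])
          show "subgroup L G" "?\<gamma> j \<lhd> G" "subgroup B G"
            by (rule L.subgroup_axioms Y.normal_axioms B.subgroup_axioms)+
          show "invariant_subgroup (?\<gamma> j)"
            by (simp add: invariant_subgroup_def operator_lower_central Y.subgroup_axioms)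
          show "h \<otimes> y \<otimes> inv h \<in> B" if "y \<in> ?\<gamma> j \<inter> B" for y
          proof -
            have "(h \<otimes> y \<otimes> inv h \<otimes> inv y) \<otimes> y \<in> B"
            proof (rule B.m_closed)
              show "h \<otimes> y \<otimes> inv h \<otimes> inv y \<in> B"
                using that W_le commutator_in_lower_central[OF hc] by blast
              show "y \<in> B" using that by blast
            qed
            then show ?thesis using hc that by (simp add: m_assoc)
          qed
          show "invariant_subgroup ((\<lambda>b. h \<otimes> b \<otimes> inv h) ` B)"
            unfolding invariant_subgroup_def
          proof (intro conjI ballI)
            show "subgroup ((\<lambda>b. h \<otimes> b \<otimes> inv h) ` B) G"
              by (rule subgroup_conjugate[OF B.subgroup_axioms hc])
            fix \<phi> a assume \<phi>: "\<phi> \<in> \<Phi>" and "a \<in> (\<lambda>b. h \<otimes> b \<otimes> inv h) ` B"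
            then obtain b where b: "b \<in> B" "a = h \<otimes> b \<otimes> inv h" by blast
            \<comment> \<open>\<open>h\<close> is fixed modulo \<open>N\<close> from either side: \<open>\<phi>(h) = k h\<close> with \<open>k \<in> N\<close> as the
                operator series drops, and \<open>\<phi>(h) = h (h\<^sup>-\<^sup>1 k h)\<close> with \<open>h\<^sup>-\<^sup>1 k h \<in> N\<close> as the
                lower central series drops.\<close>
            define k where "k = \<phi> h \<otimes> inv h"
            have \<phi>h: "\<phi> h \<in> ?\<gamma> i" by (rule operator_lower_central[OF \<phi> h(1)])
            have "k \<in> ?\<gamma> i" using \<phi>h h(1) by (simp add: k_def)
            moreover have "k \<in> op_series (Suc n)"
              using op_commutator_incl[OF \<phi> h(2)] by (simp add: k_def)
            ultimately have kN: "k \<in> N" using X.IH by blast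
            have kc: "k \<in> carrier G" using \<open>k \<in> ?\<gamma> i\<close> by simp
            have "inv k \<otimes> inv h \<otimes> inv (inv k) \<otimes> inv (inv h) \<in> ?\<gamma> (Suc i)"
              using kc h(1) by (intro commutator_in_lower_central) simp_all
            then have "inv k \<otimes> inv h \<otimes> k \<otimes> h \<in> N"
              using step.IH kc hc by auto
            then have "k \<otimes> (inv k \<otimes> inv h \<otimes> k \<otimes> h) \<in> N"
              using kN by (rule N_mult[rotated])
            moreover have "k \<otimes> (inv k \<otimes> inv h \<otimes> k \<otimes> h) = inv h \<otimes> \<phi> h"
              using kc hc by (simp add: m_assoc) (simp add: k_def m_assoc operator_closed[OF \<phi>])
            ultimately have "(inv h \<otimes> \<phi> h) \<otimes> \<phi> b \<otimes> inv (inv h \<otimes> \<phi> h) \<in> B"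
              using B_inv[OF \<phi> b(1)] by (simp add: N_def)
            moreover have "\<phi> a = h \<otimes> ((inv h \<otimes> \<phi> h) \<otimes> \<phi> b \<otimes> inv (inv h \<otimes> \<phi> h)) \<otimes> inv h"
              using b hc by (simp add: m_assoc inv_mult_group operator_simps[OF \<phi>])
            ultimately show "\<phi> a \<in> (\<lambda>b. h \<otimes> b \<otimes> inv h) ` B" by blast
          qed
        qed (fact L(2) L(3) norm L_le B_le hc)+
        then show ?thesis using b by blast
      qed
      show ?case
      proof
        fix h assume h: "h \<in> ?\<gamma> i \<inter> op_series n"
        then have hi: "inv h \<in> ?\<gamma> i" "inv h \<in> op_series n" and hc: "h \<in> carrier G"
          by simp_all
        have "h \<otimes> b \<otimes> inv h \<in> B" "inv h \<otimes> b \<otimes> h \<in> B" if "b \<in> B" for b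
          using h hi into[of h b] into[of "inv h" b] that hc by simp_all
        with hc show "h \<in> N" by (simp add: N_def)
      qed
    qed
    from this[of 0] show ?case using I.subset by (simp add: Int_absorb2)
  qed
  from this[of 0] have "carrier G \<subseteq> N" by simp
  then have "h \<otimes> b \<otimes> inv h \<in> B" if "h \<in> carrier G" "b \<in> B" for h b
    using that by (auto simp: N_def)
  then show ?thesis
    unfolding B_def[symmetric] by (intro normal_invI B.subgroup_axioms)
qed

text \<open>
  Starting from \<open>\<gamma>\<^sub>0 L = G\<close>, the step leads down to the trivial term of the lower central series.
\<close>

theorem stable_op_series_normal:
  assumes "nilpotent_group G"
    and L: "op_series m = L" "op_commutator L = L"
  shows "L \<lhd> G"
proof -
  obtain c where c: "lower_central G c = {\<one>}"
    using assms(1) by (auto simp: nilpotent_group_def)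
  have inv: "invariant_subgroup L"
    using invariant_op_series[of m] L(1) by simp
  then interpret L: subgroup L G by (simp add: invariant_subgroup_def)
  have "lower_central G j <#> L \<lhd> G" for j
  proof (induction j)
    case 0
    have "carrier G <#> L = carrier G"
      using L.subset by (auto simp: set_mult_def intro!: bexI[of _ \<one>])
    then show ?case by (simp add: normal_inv_iff subgroup_self)
  next
    case (Suc j)
    then show ?case using normal_lower_central_step[OF inv _ _ c] L by blast
  qed
  from this[of c] have "{\<one>} <#> L \<lhd> G" by (simp add: c)
  moreover have "{\<one>} <#> L = L" by (auto simp: set_mult_def)
  ultimately show ?thesis by simp
qed

text \<open>A term of least cardinality is repeated from then on.\<close>

lemma op_series_stabilizes:
  assumes "finite (carrier G)"
  obtains m where "(\<Inter>n. op_series n) = op_series m" "op_commutator (op_series m) = op_series m"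
proof -
  obtain m where least: "\<And>n. card (op_series m) \<le> card (op_series n)"
    using ex_has_least_nat[of "\<lambda>_. True" 0 "\<lambda>n. card (op_series n)"] by blast
  have "op_series m \<subseteq> carrier G"
    using invariant_op_series by (simp add: invariant_subgroup_def subgroup.subset)
  then have "finite (op_series m)"
    using assms finite_subset by blast
  then have stable: "op_series (Suc m) = op_series m"
    using op_series_decreasing least by (rule card_seteq)
  have "op_series n = op_series m" if "m \<le> n" for n
    using that
  proof (induction rule: dec_induct)
    case (step n)
    then show ?case using stable by simp
  qed simp
  moreover have "op_series m \<subseteq> op_series n" if "n \<le> m" for n
    using lift_Suc_antimono_le[of op_series, OF op_series_decreasing that] .
  ultimately have "op_series m \<subseteq> op_series n" for n
    by (metis nat_le_linear order_refl)
  then have "(\<Inter>n. op_series n) = op_series m"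
    by blast
  with stable show ?thesis by (intro that) simp_all
qed

end

section \<open>Kernels, actions and affine groups\<close>

lemma kernel_restrict:
  "L \<subseteq> carrier A \<Longrightarrow> kernel (A\<lparr>carrier := L\<rparr>) (S\<lparr>carrier := X\<rparr>) f = L \<inter> kernel A S f"
  by (auto simp: kernel_def)

lemma image_trivial_iff:
  "L \<subseteq> carrier A \<Longrightarrow> f ` L \<subseteq> {\<one>\<^bsub>S\<^esub>} \<longleftrightarrow> L \<subseteq> kernel A S f"
  by (auto simp: kernel_def)

text \<open>
  Bijectivity of each \<open>\<phi> g\<close> need not be checked separately: \<open>\<phi> (g\<^sup>-\<^sup>1)\<close> is its inverse. Extensionality
  is needed because \<^const>\<open>BijGroup\<close> consists of extensional functions.
\<close>

lemma group_actionI: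
  assumes "group S"
    and closed: "\<And>g x. \<lbrakk>g \<in> carrier S; x \<in> E\<rbrakk> \<Longrightarrow> \<phi> g x \<in> E"
    and ext: "\<And>g. g \<in> carrier S \<Longrightarrow> \<phi> g \<in> extensional E"
    and one: "\<And>x. x \<in> E \<Longrightarrow> \<phi> \<one>\<^bsub>S\<^esub> x = x"
    and mult: "\<And>g h x. \<lbrakk>g \<in> carrier S; h \<in> carrier S; x \<in> E\<rbrakk> \<Longrightarrow> \<phi> (g \<otimes>\<^bsub>S\<^esub> h) x = \<phi> g (\<phi> h x)"
  shows "group_action S E \<phi>"
proof -
  interpret S: group S by (rule assms(1))
  have bij: "\<phi> g \<in> Bij E" if g: "g \<in> carrier S" for g
  proof -
    have "\<phi> (inv\<^bsub>S\<^esub> g) (\<phi> g x) = x" "\<phi> g (\<phi> (inv\<^bsub>S\<^esub> g) x) = x" if "x \<in> E" for x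
      using g that by (simp_all add: one flip: mult)
    then have "bij_betw (\<phi> g) E E"
      using g by (intro bij_betw_byWitness[where f' = "\<phi> (inv\<^bsub>S\<^esub> g)"]) (auto simp: closed)
    then show ?thesis using ext[OF g] by (simp add: Bij_def)
  qed
  have "\<phi> \<in> hom S (BijGroup E)"
  proof (rule homI)
    fix g h assume gh: "g \<in> carrier S" "h \<in> carrier S"
    have "\<phi> (g \<otimes>\<^bsub>S\<^esub> h) = compose E (\<phi> g) (\<phi> h)"
      using gh by (intro extensionalityI[of _ E] ext) (auto simp: compose_eq mult)
    then show "\<phi> (g \<otimes>\<^bsub>S\<^esub> h) = \<phi> g \<otimes>\<^bsub>BijGroup E\<^esub> \<phi> h"
      using gh by (simp add: BijGroup_def bij)
  qed (simp add: BijGroup_def bij)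
  then show ?thesis
    by (simp add: group_action_def group_hom_def group_hom_axioms_def group_BijGroup S.group_axioms)
qed

locale affine_group = Q: group Q for Q :: "('q, 'b) monoid_scheme" +
  fixes D :: "('q \<Rightarrow> 'q) set"
  assumes subgroup_D: "subgroup D (AutoGroup Q)"
begin

abbreviation Aff :: "('q \<times> ('q \<Rightarrow> 'q)) monoid" where
  "Aff \<equiv> semidirect Q ((AutoGroup Q)\<lparr>carrier := D\<rparr>)"

lemma group_D: "group ((AutoGroup Q)\<lparr>carrier := D\<rparr>)"
  by (rule subgroup.subgroup_is_group[OF subgroup_D Q.AutoGroup])

lemma D_auto: "\<delta> \<in> D \<Longrightarrow> \<delta> \<in> auto Q"
  using subgroup.subset[OF subgroup_D] by (auto simp: AutoGroup_def)

lemma D_closed: "\<lbrakk>\<delta> \<in> D; q \<in> carrier Q\<rbrakk> \<Longrightarrow> \<delta> q \<in> carrier Q"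
  using D_auto[of \<delta>] hom_in_carrier[of \<delta> Q Q q] by (simp add: auto_def)

lemma D_mult: "\<lbrakk>\<delta> \<in> D; q \<in> carrier Q; r \<in> carrier Q\<rbrakk> \<Longrightarrow> \<delta> (q \<otimes>\<^bsub>Q\<^esub> r) = \<delta> q \<otimes>\<^bsub>Q\<^esub> \<delta> r"
  using D_auto[of \<delta>] hom_mult[of \<delta> Q Q q r] by (simp add: auto_def)

lemma D_one: "\<delta> \<in> D \<Longrightarrow> \<delta> \<one>\<^bsub>Q\<^esub> = \<one>\<^bsub>Q\<^esub>"
  using D_auto hom_one[OF _ Q.group_axioms Q.group_axioms] by (auto simp: auto_def)

lemma D_comp:
  assumes "\<alpha> \<in> D" "\<beta> \<in> D"
  shows "\<alpha> \<otimes>\<^bsub>AutoGroup Q\<^esub> \<beta> = compose (carrier Q) \<alpha> \<beta>"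
  using assms[THEN D_auto] by (simp add: AutoGroup_def BijGroup_def auto_def)

lemma one_AutoGroup: "\<one>\<^bsub>AutoGroup Q\<^esub> = (\<lambda>q\<in>carrier Q. q)"
  by (simp add: AutoGroup_def BijGroup_def)

lemma group_Aff: "group Aff"
proof -
  interpret D: group "(AutoGroup Q)\<lparr>carrier := D\<rparr>" by (rule group_D)
  have one: "\<one>\<^bsub>AutoGroup Q\<^esub> \<in> D" using D.one_closed by simp
  have mult: "\<alpha> \<otimes>\<^bsub>AutoGroup Q\<^esub> \<beta> \<in> D" if "\<alpha> \<in> D" "\<beta> \<in> D" for \<alpha> \<beta>
    using D.m_closed that by simp
  show ?thesis
  proof (rule groupI)
    fix x assume "x \<in> carrier Aff"
    then obtain q \<delta> where x: "x = (q, \<delta>)" "q \<in> carrier Q" "\<delta> \<in> D"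
      by (auto simp: semidirect_def)
    \<comment> \<open>The inverse of \<open>(q, \<delta>)\<close> is \<open>(\<epsilon>(q)\<^sup>-\<^sup>1, \<epsilon>)\<close> with \<open>\<epsilon> = \<delta>\<^sup>-\<^sup>1\<close>.\<close>
    obtain \<epsilon> where \<epsilon>: "\<epsilon> \<in> D" "\<epsilon> \<otimes>\<^bsub>AutoGroup Q\<^esub> \<delta> = \<one>\<^bsub>AutoGroup Q\<^esub>"
      using D.l_inv_ex[of \<delta>] x(3) by auto
    have "(inv\<^bsub>Q\<^esub> \<epsilon> q, \<epsilon>) \<otimes>\<^bsub>Aff\<^esub> x = \<one>\<^bsub>Aff\<^esub>"
      using \<epsilon> x D_closed by (simp add: semidirect_def)
    moreover have "(inv\<^bsub>Q\<^esub> \<epsilon> q, \<epsilon>) \<in> carrier Aff"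
      using \<epsilon> x D_closed by (simp add: semidirect_def)
    ultimately show "\<exists>y\<in>carrier Aff. y \<otimes>\<^bsub>Aff\<^esub> x = \<one>\<^bsub>Aff\<^esub>" by blast
  next
    fix x y z assume "x \<in> carrier Aff" "y \<in> carrier Aff" "z \<in> carrier Aff"
    then show "x \<otimes>\<^bsub>Aff\<^esub> y \<otimes>\<^bsub>Aff\<^esub> z = x \<otimes>\<^bsub>Aff\<^esub> (y \<otimes>\<^bsub>Aff\<^esub> z)"
      using D.m_assoc
      by (auto simp: semidirect_def D_comp compose_eq D_mult D_closed Q.m_assoc)
  qed (auto simp: semidirect_def one mult D_closed one_AutoGroup[symmetric] D.l_one[simplified], simp add: one_AutoGroup)
qed

lemma affine_action: "group_action Aff (carrier Q) (affine_act Q)"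
proof (rule group_actionI[OF group_Aff])
  interpret D: group "(AutoGroup Q)\<lparr>carrier := D\<rparr>" by (rule group_D)
  show "affine_act Q \<one>\<^bsub>Aff\<^esub> x = x" if "x \<in> carrier Q" for x
    using that by (simp add: affine_act_def semidirect_def one_AutoGroup)
  show "affine_act Q (g \<otimes>\<^bsub>Aff\<^esub> h) x = affine_act Q g (affine_act Q h x)"
    if "g \<in> carrier Aff" "h \<in> carrier Aff" "x \<in> carrier Q" for g h x
    using that by (auto simp: affine_act_def semidirect_def D_comp compose_eq D_mult D_closed Q.m_assoc)
qed (auto simp: affine_act_def semidirect_def D_closed)

text \<open>
  The value of an affine map at the identity is its translation part, and what remains after
  cancelling it is the linear part.
\<close>

lemma affine_faithful: "inj_on (affine_act Q) (carrier Aff)"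
proof (rule inj_onI)
  fix g h assume "g \<in> carrier Aff" "h \<in> carrier Aff" and eq: "affine_act Q g = affine_act Q h"
  then obtain q \<alpha> r \<beta> where g: "g = (q, \<alpha>)" "q \<in> carrier Q" "\<alpha> \<in> D"
    and h: "h = (r, \<beta>)" "r \<in> carrier Q" "\<beta> \<in> D"
    by (auto simp: semidirect_def)
  have act: "q \<otimes>\<^bsub>Q\<^esub> \<alpha> x = r \<otimes>\<^bsub>Q\<^esub> \<beta> x" if "x \<in> carrier Q" for x
    using fun_cong[OF eq, of x] that by (simp add: affine_act_def g h)
  from act[of "\<one>\<^bsub>Q\<^esub>"] have "q = r" using g h by (simp add: D_one)
  then have "\<alpha> x = \<beta> x" if "x \<in> carrier Q" for x
    using act[OF that] g h that by (simp add: D_closed)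
  moreover have "\<alpha> \<in> extensional (carrier Q)" "\<beta> \<in> extensional (carrier Q)"
    using g(3) h(3) by (auto dest!: D_auto simp: auto_def Bij_def)
  ultimately have "\<alpha> = \<beta>" by (intro extensionalityI[of _ "carrier Q"])
  with \<open>q = r\<close> show "g = h" by (simp add: g h)
qed

end

section \<open>Strong left ideals and their affine permutation groups\<close>

context skew_brace
begin

abbreviation lam :: "'a \<Rightarrow> 'a \<Rightarrow> 'a" where
  "lam \<equiv> brace_lambda G A"

lemma mul_closed [simp]: "\<lbrakk>a \<in> carrier G; b \<in> carrier G\<rbrakk> \<Longrightarrow> a \<otimes>\<^bsub>A\<^esub> b \<in> carrier G"
  using mul.m_closed by (simp add: same_carrier)

lemma mul_inv_closed [simp]: "a \<in> carrier G \<Longrightarrow> inv\<^bsub>A\<^esub> a \<in> carrier G"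
  using mul.inv_closed by (simp add: same_carrier)

lemma lam_closed [simp]: "\<lbrakk>a \<in> carrier G; b \<in> carrier G\<rbrakk> \<Longrightarrow> lam a b \<in> carrier G"
  by (simp add: brace_lambda_def)

lemma mul_eq_add_lam: "\<lbrakk>a \<in> carrier G; b \<in> carrier G\<rbrakk> \<Longrightarrow> a \<otimes>\<^bsub>A\<^esub> b = a \<otimes>\<^bsub>G\<^esub> lam a b"
  by (simp add: brace_lambda_def flip: add.m_assoc)

lemma lam_add:
  "\<lbrakk>a \<in> carrier G; b \<in> carrier G; c \<in> carrier G\<rbrakk> \<Longrightarrow> lam a (b \<otimes>\<^bsub>G\<^esub> c) = lam a b \<otimes>\<^bsub>G\<^esub> lam a c"
  by (simp add: brace_lambda_def brace_distrib add.m_assoc)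

lemma lam_hom: "a \<in> carrier G \<Longrightarrow> lam a \<in> hom G G"
  by (simp add: hom_def lam_add)

lemma lam_mul:
  assumes "a \<in> carrier G" "b \<in> carrier G" "c \<in> carrier G"
  shows "lam (a \<otimes>\<^bsub>A\<^esub> b) c = lam a (lam b c)"
proof -
  have "(a \<otimes>\<^bsub>A\<^esub> b) \<otimes>\<^bsub>G\<^esub> lam (a \<otimes>\<^bsub>A\<^esub> b) c = a \<otimes>\<^bsub>A\<^esub> (b \<otimes>\<^bsub>A\<^esub> c)"
    using assms mul.m_assoc by (simp add: same_carrier flip: mul_eq_add_lam)
  also have "\<dots> = a \<otimes>\<^bsub>G\<^esub> lam a (b \<otimes>\<^bsub>G\<^esub> lam b c)"
    using assms by (simp add: mul_eq_add_lam)
  also have "\<dots> = (a \<otimes>\<^bsub>A\<^esub> b) \<otimes>\<^bsub>G\<^esub> lam a (lam b c)"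
    using assms by (simp add: mul_eq_add_lam lam_add add.m_assoc)
  finally show ?thesis using assms by simp
qed

lemma lam_unit [simp]: "b \<in> carrier G \<Longrightarrow> lam \<one>\<^bsub>G\<^esub> b = b"
  using mul.l_one[of b] by (simp add: brace_lambda_def same_carrier common_identity)

lemma lam_inv_cancel [simp]:
  assumes "a \<in> carrier G" "b \<in> carrier G"
  shows "lam (inv\<^bsub>A\<^esub> a) (lam a b) = b" "lam a (lam (inv\<^bsub>A\<^esub> a) b) = b"
  using assms mul.l_inv mul.r_inv by (simp_all add: same_carrier common_identity flip: lam_mul)

end

locale strong_left_ideal = skew_brace +
  fixes L
  assumes add_normal: "L \<lhd> G"
    and lam_invariant: "\<lbrakk>a \<in> carrier G; x \<in> L\<rbrakk> \<Longrightarrow> lam a x \<in> L"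
begin

sublocale L: normal L G by (rule add_normal)

abbreviation "Q \<equiv> G Mod L"
abbreviation "ind a \<equiv> induced_map G L (lam a)"
abbreviation "\<Delta> \<equiv> ind ` carrier A"

lemma coset_in_Q [simp]: "b \<in> carrier G \<Longrightarrow> L #>\<^bsub>G\<^esub> b \<in> carrier Q"
  by (simp add: carrier_FactGroup)

lemma ind_coset:
  assumes a: "a \<in> carrier G" and b: "b \<in> carrier G"
  shows "ind a (L #>\<^bsub>G\<^esub> b) = L #>\<^bsub>G\<^esub> lam a b"
proof -
  have "lam a ` (L #>\<^bsub>G\<^esub> b) = L #>\<^bsub>G\<^esub> lam a b"
  proof (intro subset_antisym subsetI)
    fix x assume "x \<in> lam a ` (L #>\<^bsub>G\<^esub> b)"
    then obtain l where "l \<in> L" "x = lam a (l \<otimes>\<^bsub>G\<^esub> b)" by (auto simp: r_coset_def)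
    then show "x \<in> L #>\<^bsub>G\<^esub> lam a b"
      using a b lam_invariant[OF a] by (auto simp: lam_add r_coset_def)
  next
    fix x assume "x \<in> L #>\<^bsub>G\<^esub> lam a b"
    then obtain l where l: "l \<in> L" "x = l \<otimes>\<^bsub>G\<^esub> lam a b" by (auto simp: r_coset_def)
    then have "x = lam a (lam (inv\<^bsub>A\<^esub> a) l \<otimes>\<^bsub>G\<^esub> b)" using a b by (simp add: lam_add)
    moreover have "lam (inv\<^bsub>A\<^esub> a) l \<in> L" using a l by (simp add: lam_invariant)
    ultimately show "x \<in> lam a ` (L #>\<^bsub>G\<^esub> b)" by (auto simp: r_coset_def)
  qed
  then show ?thesis using b by (simp add: induced_map_def)
qed

text \<open>
  Establishing an action of \<open>A\<close> on the set \<open>Q\<close> first makes the induced maps bijective.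
\<close>

lemma ind_action: "group_action A (carrier Q) ind"
proof (rule group_actionI[OF mul.group_axioms])
  show "ind g \<in> extensional (carrier Q)" for g by (simp add: induced_map_def)
qed (auto simp: carrier_FactGroup ind_coset same_carrier common_identity lam_mul)

lemma ind_auto:
  assumes "a \<in> carrier G" shows "ind a \<in> auto Q"
  using assms group_action.bij_prop0[OF ind_action, of a]
  by (auto simp: auto_def same_carrier hom_def carrier_FactGroup ind_coset lam_add L.rcos_sum)

lemma ind_hom: "ind \<in> hom A (AutoGroup Q)"
  using group_hom.hom_mult[OF group_action.group_hom[OF ind_action]]
  by (auto simp: hom_def AutoGroup_def ind_auto same_carrier)

lemma subgroup_Delta: "subgroup \<Delta> (AutoGroup Q)"
proof -
  interpret Q: group Q by (rule L.factorgroup_is_group)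
  have "group_hom A (AutoGroup Q) ind"
    by (simp add: group_hom_def group_hom_axioms_def ind_hom Q.AutoGroup mul.group_axioms)
  then show ?thesis
    by (rule group_hom.subgroup_img_is_subgroup[OF _ mul.subgroup_self])
qed

sublocale aff: affine_group Q \<Delta>
  by (simp add: affine_group_def affine_group_axioms_def L.factorgroup_is_group subgroup_Delta)

abbreviation "\<theta> a \<equiv> (L #>\<^bsub>G\<^esub> a, ind a)"
abbreviation "S \<equiv> aff.Aff"
abbreviation "H \<equiv> S\<lparr>carrier := \<theta> ` carrier A\<rparr>"

lemma theta_hom: "\<theta> \<in> hom A S"
proof (rule homI)
  fix a b assume "a \<in> carrier A" "b \<in> carrier A"
  then show "\<theta> (a \<otimes>\<^bsub>A\<^esub> b) = \<theta> a \<otimes>\<^bsub>S\<^esub> \<theta> b"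
    using hom_mult[OF ind_hom]
    by (simp add: same_carrier semidirect_def ind_coset L.rcos_sum mul_eq_add_lam)
qed (auto simp: semidirect_def same_carrier)

lemma theta_group_hom: "group_hom A S \<theta>"
  by (simp add: group_hom_def group_hom_axioms_def theta_hom aff.group_Aff mul.group_axioms)

text \<open>
  On cosets, \<open>\<theta>(a)\<close> is left multiplication by \<open>a\<close> in \<open>A\<close>; all facts about the action of \<open>H\<close>
  reduce to this.
\<close>

lemma theta_act:
  assumes "a \<in> carrier G" "b \<in> carrier G"
  shows "affine_act Q (\<theta> a) (L #>\<^bsub>G\<^esub> b) = L #>\<^bsub>G\<^esub> (a \<otimes>\<^bsub>A\<^esub> b)"
  using assms by (simp add: affine_act_def ind_coset L.rcos_sum mul_eq_add_lam)

lemma coset_eq_L_iff: "a \<in> carrier G \<Longrightarrow> L #>\<^bsub>G\<^esub> a = L \<longleftrightarrow> a \<in> L"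
  using add.coset_join1 add.coset_join2 L.subgroup_axioms by blast

text \<open>
  Although \<open>L\<close> need not be normal in \<open>A\<close>, its additive cosets are its left cosets in \<open>A\<close>, because
  \<open>b \<cdot> L = b + \<lambda>\<^sub>b(L) = b + L\<close>.
\<close>

lemma mul_coset_eq_iff:
  assumes "b \<in> carrier G" "c \<in> carrier G"
  shows "L #>\<^bsub>G\<^esub> (b \<otimes>\<^bsub>A\<^esub> c) = L #>\<^bsub>G\<^esub> b \<longleftrightarrow> c \<in> L"
proof -
  have "L #>\<^bsub>G\<^esub> (b \<otimes>\<^bsub>A\<^esub> c) = (L #>\<^bsub>G\<^esub> b) \<otimes>\<^bsub>Q\<^esub> (L #>\<^bsub>G\<^esub> lam b c)"
    using assms by (simp add: mul_eq_add_lam L.rcos_sum)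
  then have "L #>\<^bsub>G\<^esub> (b \<otimes>\<^bsub>A\<^esub> c) = L #>\<^bsub>G\<^esub> b \<longleftrightarrow> L #>\<^bsub>G\<^esub> lam b c = L"
    using assms aff.Q.l_cancel_one[of "L #>\<^bsub>G\<^esub> b" "L #>\<^bsub>G\<^esub> lam b c"] by simp
  also have "\<dots> \<longleftrightarrow> lam b c \<in> L" using assms by (simp add: coset_eq_L_iff)
  also have "\<dots> \<longleftrightarrow> c \<in> L"
    using assms lam_invariant[of b c] lam_invariant[of "inv\<^bsub>A\<^esub> b" "lam b c"] by auto
  finally show ?thesis .
qed

lemma mul_subgroup: "subgroup L A"
proof (rule mul.subgroupI)
  show "L \<subseteq> carrier A" using L.subset by (simp add: same_carrier)
  show "L \<noteq> {}" using L.one_closed by blast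
  fix a assume a: "a \<in> L"
  have "L #>\<^bsub>G\<^esub> (a \<otimes>\<^bsub>A\<^esub> inv\<^bsub>A\<^esub> a) = L #>\<^bsub>G\<^esub> a"
    using a mul.r_inv[of a] L.rcos_const[OF add.group_axioms, of a]
      L.rcos_const[OF add.group_axioms L.one_closed]
    by (simp add: same_carrier common_identity)
  then show "inv\<^bsub>A\<^esub> a \<in> L" using a by (simp add: mul_coset_eq_iff)
  fix b assume "b \<in> L"
  with a show "a \<otimes>\<^bsub>A\<^esub> b \<in> L" by (simp add: mul_eq_add_lam lam_invariant)
qed

lemma kernel_theta_iff: "a \<in> kernel A S \<theta> \<longleftrightarrow> a \<in> L \<and> ind a = (\<lambda>U\<in>carrier Q. U)"
proof -
  have "\<one>\<^bsub>S\<^esub> = (L, \<lambda>U\<in>carrier Q. U)"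
    by (simp add: semidirect_def aff.one_AutoGroup)
  then have "a \<in> kernel A S \<theta> \<longleftrightarrow> a \<in> carrier G \<and> L #>\<^bsub>G\<^esub> a = L \<and> ind a = (\<lambda>U\<in>carrier Q. U)"
    by (simp only: kernel_def mem_Collect_eq prod.inject same_carrier)
  then show ?thesis using coset_eq_L_iff L.mem_carrier by blast
qed

lemma kernel_theta_le: "kernel A S \<theta> \<subseteq> L"
  using kernel_theta_iff by blast

text \<open>
  An element \<open>a\<close> of a normal subgroup \<open>N \<subseteq> L\<close> of \<open>A\<close> fixes every coset: \<open>a \<cdot> b = b \<cdot> c\<close> for the
  conjugate \<open>c \<in> N \<subseteq> L\<close>, so \<open>a \<cdot> b\<close> lies in \<open>b + L\<close>. As \<open>a \<in> L\<close>, its translation part is trivial,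
  and hence so is its linear part.
\<close>

lemma normal_le_kernel_theta:
  assumes "N \<lhd> A" "N \<subseteq> L"
  shows "N \<subseteq> kernel A S \<theta>"
proof
  interpret N: normal N A by (rule assms(1))
  fix a assume aN: "a \<in> N"
  then have a: "a \<in> L" "a \<in> carrier G" using assms(2) by auto
  have "ind a (L #>\<^bsub>G\<^esub> b) = L #>\<^bsub>G\<^esub> b" if b: "b \<in> carrier G" for b
  proof -
    define c where "c = inv\<^bsub>A\<^esub> b \<otimes>\<^bsub>A\<^esub> a \<otimes>\<^bsub>A\<^esub> b"
    have "c \<in> N" unfolding c_def using aN b by (intro N.inv_op_closed1) (simp_all add: same_carrier)
    then have c: "c \<in> L" "c \<in> carrier G" using assms(2) by auto
      have "ind a (L #>\<^bsub>G\<^esub> b) = (L #>\<^bsub>G\<^esub> a) \<otimes>\<^bsub>Q\<^esub> (L #>\<^bsub>G\<^esub> lam a b)"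
      using a b aff.Q.l_one[of "L #>\<^bsub>G\<^esub> lam a b"] by (simp add: ind_coset L.rcos_const)
    also have "\<dots> = L #>\<^bsub>G\<^esub> (a \<otimes>\<^bsub>A\<^esub> b)"
      using a b by (simp add: L.rcos_sum mul_eq_add_lam)
    also have "a \<otimes>\<^bsub>A\<^esub> b = b \<otimes>\<^bsub>A\<^esub> c"
      using a b mul.m_assoc[of b "inv\<^bsub>A\<^esub> b \<otimes>\<^bsub>A\<^esub> a" b] mul.m_assoc[of b "inv\<^bsub>A\<^esub> b" a] mul.r_inv[of b]
        mul.l_one[of a]
      by (simp add: c_def same_carrier)
    also have "L #>\<^bsub>G\<^esub> (b \<otimes>\<^bsub>A\<^esub> c) = L #>\<^bsub>G\<^esub> b" using b c by (simp add: mul_coset_eq_iff)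
    finally show ?thesis .
  qed
  then have "ind a = (\<lambda>U\<in>carrier Q. U)"
    by (intro extensionalityI[of _ "carrier Q"]) (auto simp: induced_map_def carrier_FactGroup)
  then show "a \<in> kernel A S \<theta>"
    using a(1) kernel_theta_iff by blast
qed

lemma normal_core_eq_kernel: "normal_core A L = kernel A S \<theta>"
  unfolding normal_core_def
  by (rule Greatest_equality)
    (simp_all add: group_hom.normal_kernel[OF theta_group_hom] kernel_theta_le normal_le_kernel_theta)

lemma subgroup_H: "subgroup (\<theta> ` carrier A) S"
  by (rule group_hom.subgroup_img_is_subgroup[OF theta_group_hom mul.subgroup_self])

lemma H_action: "group_action H (carrier Q) (affine_act Q)"
proof -
  interpret act: group_action S "carrier Q" "affine_act Q" by (rule aff.affine_action)
  have H_S: "g \<in> carrier S" if "g \<in> carrier H" for g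
    by (rule subsetD[OF subgroup.subset[OF subgroup_H]]) (use that in simp)
  show ?thesis
  proof (rule group_actionI)
    show "group H" by (rule subgroup.subgroup_is_group[OF subgroup_H aff.group_Aff])
    show "affine_act Q g x \<in> carrier Q" if "g \<in> carrier H" "x \<in> carrier Q" for g x
      by (rule act.element_image[OF H_S[OF that(1)] that(2) refl])
    show "affine_act Q g \<in> extensional (carrier Q)" if "g \<in> carrier H" for g
      by (rule Bij_imp_extensional[OF act.bij_prop0[OF H_S[OF that]]])
    show "affine_act Q \<one>\<^bsub>H\<^esub> x = x" if "x \<in> carrier Q" for x
      using fun_cong[OF act.id_eq_one, of x] that by simp
    show "affine_act Q (g \<otimes>\<^bsub>H\<^esub> h) x = affine_act Q g (affine_act Q h x)"
      if "g \<in> carrier H" "h \<in> carrier H" "x \<in> carrier Q" for g h x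
      using act.composition_rule[OF that(3) H_S[OF that(1)] H_S[OF that(2)]] by simp
  qed
qed

lemma H_faithful: "faithful_action H (carrier Q) (affine_act Q)"
  using H_action inj_on_subset[OF aff.affine_faithful subgroup.subset[OF subgroup_H]]
  by (simp add: faithful_action_def faithful_action_axioms_def)

lemma H_transitive: "transitive_action H (carrier Q) (affine_act Q)"
proof -
  have "\<exists>g\<in>carrier H. affine_act Q g (L #>\<^bsub>G\<^esub> b) = L #>\<^bsub>G\<^esub> c"
    if "b \<in> carrier G" "c \<in> carrier G" for b c
  proof
    show "affine_act Q (\<theta> (c \<otimes>\<^bsub>A\<^esub> inv\<^bsub>A\<^esub> b)) (L #>\<^bsub>G\<^esub> b) = L #>\<^bsub>G\<^esub> c"
      using that mul.m_assoc[of c "inv\<^bsub>A\<^esub> b" b] mul.l_inv[of b] mul.r_one[of c]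
      by (simp add: theta_act same_carrier)
  qed (use that in \<open>simp add: same_carrier\<close>)
  then show ?thesis
    using H_action
    by (auto simp: transitive_action_def transitive_action_axioms_def carrier_FactGroup)
qed

text \<open>
  Stabilizers of arbitrary cosets are needed for regularity; they are the images of the conjugates
  of \<open>L\<close> in \<open>A\<close>.
\<close>

lemma H_stabilizer_coset:
  assumes "b \<in> carrier G"
  shows "stabilizer H (affine_act Q) (L #>\<^bsub>G\<^esub> b)
    = \<theta> ` {a \<in> carrier G. inv\<^bsub>A\<^esub> b \<otimes>\<^bsub>A\<^esub> a \<otimes>\<^bsub>A\<^esub> b \<in> L}"
proof -
  have "affine_act Q (\<theta> a) (L #>\<^bsub>G\<^esub> b) = L #>\<^bsub>G\<^esub> b \<longleftrightarrow> inv\<^bsub>A\<^esub> b \<otimes>\<^bsub>A\<^esub> a \<otimes>\<^bsub>A\<^esub> b \<in> L"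
    if a: "a \<in> carrier G" for a
  proof -
    define c where "c = inv\<^bsub>A\<^esub> b \<otimes>\<^bsub>A\<^esub> a \<otimes>\<^bsub>A\<^esub> b"
    have "a \<otimes>\<^bsub>A\<^esub> b = b \<otimes>\<^bsub>A\<^esub> c"
      using a assms mul.m_assoc[of b "inv\<^bsub>A\<^esub> b \<otimes>\<^bsub>A\<^esub> a" b] mul.m_assoc[of b "inv\<^bsub>A\<^esub> b" a]
        mul.r_inv[of b] mul.l_one[of a]
      by (simp add: c_def same_carrier)
    moreover have "c \<in> carrier G" using a assms by (simp add: c_def)
    ultimately show ?thesis
      using a assms mul_coset_eq_iff[of b c] by (simp add: theta_act c_def)
  qed
  then show ?thesis
    by (auto simp: stabilizer_def same_carrier)
qed

lemma H_stabilizer: "stabilizer H (affine_act Q) (L #>\<^bsub>G\<^esub> \<one>\<^bsub>G\<^esub>) = \<theta> ` L"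
proof -
  have "{a \<in> carrier G. inv\<^bsub>A\<^esub> \<one>\<^bsub>G\<^esub> \<otimes>\<^bsub>A\<^esub> a \<otimes>\<^bsub>A\<^esub> \<one>\<^bsub>G\<^esub> \<in> L} = L"
    using mul.l_one mul.r_one L.subset by (auto simp: same_carrier simp flip: common_identity)
  then show ?thesis using H_stabilizer_coset[OF add.one_closed] by simp
qed

lemma theta_L_iso: "H\<lparr>carrier := \<theta> ` L\<rparr> \<cong> (A\<lparr>carrier := L\<rparr>) Mod normal_core A L"
proof -
  interpret AL: group "A\<lparr>carrier := L\<rparr>"
    by (rule subgroup.subgroup_is_group[OF mul_subgroup mul.group_axioms])
  have "group (S\<lparr>carrier := \<theta> ` L\<rparr>)"
    by (intro subgroup.subgroup_is_group[OF _ aff.group_Aff]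
        group_hom.subgroup_img_is_subgroup[OF theta_group_hom mul_subgroup])
  moreover have "\<theta> \<in> hom (A\<lparr>carrier := L\<rparr>) (S\<lparr>carrier := \<theta> ` L\<rparr>)"
    using hom_mult[OF theta_hom] by (auto simp: hom_def same_carrier)
  ultimately interpret res: group_hom "A\<lparr>carrier := L\<rparr>" "S\<lparr>carrier := \<theta> ` L\<rparr>" \<theta>
    by (simp add: group_hom_def group_hom_axioms_def AL.group_axioms)
  have "kernel (A\<lparr>carrier := L\<rparr>) (S\<lparr>carrier := \<theta> ` L\<rparr>) \<theta> = normal_core A L"
    unfolding normal_core_eq_kernel kernel_restrict[OF subgroup.subset[OF mul_subgroup]]
    using kernel_theta_le by (rule Int_absorb1)
  then have "(A\<lparr>carrier := L\<rparr>) Mod normal_core A L \<cong> S\<lparr>carrier := \<theta> ` L\<rparr>"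
    and "group ((A\<lparr>carrier := L\<rparr>) Mod normal_core A L)"
    using res.FactGroup_iso normal.factorgroup_is_group[OF res.normal_kernel] by simp_all
  then show ?thesis
    using group.iso_sym by fastforce
qed

text \<open>
  Both sides say that \<open>L\<close> is its own core. If it is, it equals all its conjugates, so every
  stabilizer is \<open>\<theta>(L)\<close> and hence trivial; conversely the trivial stabilizer \<open>\<theta>(L)\<close> puts \<open>L\<close> into
  the kernel of \<open>\<theta>\<close>.
\<close>

lemma ideal_iff_regular: "brace_ideal G A L \<longleftrightarrow> regular_action H (carrier Q) (affine_act Q)"
proof -
  have "brace_ideal G A L \<longleftrightarrow> L \<lhd> A"
    by (auto simp: brace_ideal_def add_normal L.subgroup_axioms lam_invariant same_carrier)
  also have "\<dots> \<longleftrightarrow> kernel A S \<theta> = L"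
    using kernel_theta_le normal_le_kernel_theta[of L] group_hom.normal_kernel[OF theta_group_hom]
    by auto
  also have "\<dots> \<longleftrightarrow> regular_action H (carrier Q) (affine_act Q)"
  proof
    assume ker: "kernel A S \<theta> = L"
    then have nor: "L \<lhd> A" using group_hom.normal_kernel[OF theta_group_hom] by simp
    have "stabilizer H (affine_act Q) (L #>\<^bsub>G\<^esub> b) = {\<one>\<^bsub>H\<^esub>}" if b: "b \<in> carrier G" for b
    proof -
      have "a \<in> L" if "a \<in> carrier G" "inv\<^bsub>A\<^esub> b \<otimes>\<^bsub>A\<^esub> a \<otimes>\<^bsub>A\<^esub> b \<in> L" for a
      proof -
        have "b \<otimes>\<^bsub>A\<^esub> (inv\<^bsub>A\<^esub> b \<otimes>\<^bsub>A\<^esub> a \<otimes>\<^bsub>A\<^esub> b) \<otimes>\<^bsub>A\<^esub> inv\<^bsub>A\<^esub> b \<in> L"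
          using b that(2) by (intro normal.inv_op_closed2[OF nor]) (simp_all add: same_carrier)
        also have "b \<otimes>\<^bsub>A\<^esub> (inv\<^bsub>A\<^esub> b \<otimes>\<^bsub>A\<^esub> a \<otimes>\<^bsub>A\<^esub> b) \<otimes>\<^bsub>A\<^esub> inv\<^bsub>A\<^esub> b = a"
          using b that(1) by (metis mul.inv_closed mul.inv_solve_right mul.m_assoc mul.m_closed
              mul.inv_solve_left same_carrier)
        finally show ?thesis .
      qed
      then have "stabilizer H (affine_act Q) (L #>\<^bsub>G\<^esub> b) \<subseteq> \<theta> ` kernel A S \<theta>"
        unfolding ker H_stabilizer_coset[OF b] by blast
      also have "\<dots> \<subseteq> {\<one>\<^bsub>S\<^esub>}"
        using image_trivial_iff[OF subgroup.subset[OF mul_subgroup], of \<theta> S] by (simp only: ker)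
      finally show ?thesis
        using group_action.stabilizer_one_closed[OF H_action, of "L #>\<^bsub>G\<^esub> b"] b by auto
    qed
    then show "regular_action H (carrier Q) (affine_act Q)"
      using H_transitive unfolding regular_action_def carrier_FactGroup by blast
  next
    assume "regular_action H (carrier Q) (affine_act Q)"
    then have "stabilizer H (affine_act Q) (L #>\<^bsub>G\<^esub> \<one>\<^bsub>G\<^esub>) = {\<one>\<^bsub>H\<^esub>}"
      using coset_in_Q[OF add.one_closed] unfolding regular_action_def by blast
    then have "\<theta> ` L \<subseteq> {\<one>\<^bsub>S\<^esub>}"
      by (simp only: H_stabilizer) simp
    then have "L \<subseteq> kernel A S \<theta>"
      using image_trivial_iff[OF subgroup.subset[OF mul_subgroup], of \<theta> S] by blast
    with kernel_theta_le show "kernel A S \<theta> = L" by blast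
  qed
  finally show ?thesis .
qed

end

section \<open>The limit of the left series\<close>

context skew_brace
begin

lemma operator_group_lam: "operator_group G (lam ` carrier G)"
  using lam_hom by unfold_locales auto

lemma set_star_eq_op_commutator:
  "set_star G A (carrier G) T = operator_group.op_commutator G (lam ` carrier G) T"
  unfolding set_star_def operator_group.op_commutator_def[OF operator_group_lam] brace_star_def
  by (rule arg_cong[of _ _ "generate G"]) blast

text \<open>
  The left series is the operator series of \<open>(X,+)\<close> for the operators \<open>\<lambda>\<^sub>a\<close>, with indices shifted
  by one.
\<close>

lemma L_infty_eq: "L_infty G A = (\<Inter>n. (operator_group.op_commutator G (lam ` carrier G) ^^ n) (carrier G))"
proof -
  have "{1..} = range Suc" using not0_implies_Suc by (auto simp: image_iff)
  moreover have "set_star G A (carrier G) = operator_group.op_commutator G (lam ` carrier G)"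
    using set_star_eq_op_commutator by blast
  ultimately show ?thesis
    by (simp add: L_infty_def left_series_def image_image)
qed

theorem L_infty_strong_left_ideal:
  assumes "finite (carrier G)" "nilpotent_group G"
  shows "strong_left_ideal G A (L_infty G A)"
proof -
  interpret ops: operator_group G "lam ` carrier G" by (rule operator_group_lam)
  obtain m where m: "L_infty G A = ops.op_series m"
    "ops.op_commutator (ops.op_series m) = ops.op_series m"
    using ops.op_series_stabilizes[OF assms(1)] L_infty_eq by metis
  have "L_infty G A \<lhd> G"
    using ops.stable_op_series_normal[OF assms(2) refl m(2)] m(1) by simp
  moreover have "ops.invariant_subgroup (L_infty G A)"
    using ops.invariant_op_series m(1) by simp
  ultimately show ?thesis
    using skew_brace_axioms
    by (simp add: strong_left_ideal_def strong_left_ideal_axioms_def ops.invariant_subgroup_def)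
qed

end

theorem corollary6p8:
  fixes G A :: "'a monoid"
    and L C :: "'a set"
    and Q :: "'a set monoid"
    and \<Delta> :: "('a set \<Rightarrow> 'a set) set"
    and S H :: "('a set \<times> ('a set \<Rightarrow> 'a set)) monoid"
    and \<theta> :: "'a \<Rightarrow> 'a set \<times> ('a set \<Rightarrow> 'a set)"
  assumes "skew_brace G A"
    and "finite (carrier G)"
    and "nilpotent_group G"
    and "L = L_infty G A"
    and "Q = G Mod L"
    and "\<Delta> = (\<lambda>a. induced_map G L (brace_lambda G A a)) ` carrier A"
    and "C = normal_core A L"
    and "S = semidirect Q ((AutoGroup Q)\<lparr>carrier := \<Delta>\<rparr>)"
    and "\<theta> = (\<lambda>a. (L #>\<^bsub>G\<^esub> a, induced_map G L (brace_lambda G A a)))"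
    and "H = S\<lparr>carrier := \<theta> ` carrier A\<rparr>"
  shows "subgroup \<Delta> (AutoGroup Q) \<and>
         \<theta> \<in> hom A S \<and>
         group_action S (carrier Q) (affine_act Q) \<and>
         faithful_action H (carrier Q) (affine_act Q) \<and>
         transitive_action H (carrier Q) (affine_act Q) \<and>
         stabilizer H (affine_act Q) (L #>\<^bsub>G\<^esub> \<one>\<^bsub>G\<^esub>) = \<theta> ` L \<and>
         H\<lparr>carrier := \<theta> ` L\<rparr> \<cong> (A\<lparr>carrier := L\<rparr>) Mod C \<and>
         (brace_ideal G A L \<longleftrightarrow> regular_action H (carrier Q) (affine_act Q))"

proof -
  interpret skew_brace G A by (rule assms(1))
  interpret I: strong_left_ideal G A L
    using L_infty_strong_left_ideal[OF assms(2,3)] assms(4) by simp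
  show ?thesis
    unfolding assms(5-10)
    by (intro conjI I.subgroup_Delta I.theta_hom I.aff.affine_action I.H_faithful I.H_transitive
        I.H_stabilizer I.theta_L_iso I.ideal_iff_regular)
qed

end
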